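(* Let $\mathcal{X}\subseteq\mathbb{R}^n$ and $\mathcal{Y}\subseteq\mathbb{R}^m$ be closed convex sets, and consider the two-player game in which player $x$ solves $\min_{x\in\mathcal{X}}\theta_x(x,y)$ and player $y$ solves $\min_{y\in\mathcal{Y}}\theta_y(x,y)$, where $\theta_x(\cdot,y)$ is continuously differentiable for each fixed $y$ and $\theta_y(x,\cdot)$ is continuously differentiable for each fixed $x$. Let $\mathcal{Z}=\mathcal{X}\times\mathcal{Y}$ and $F(z)=(\nabla_x\theta_x(x,y),\nabla_y\theta_y(x,y))$ for $z=(x,y)$. Then for $z^*=(x^*,y^* )\in\mathcal{Z}$: $$z^*\in\mathrm{Sol}_m\ \Longrightarrow\ z^*\text{ is an MNE}\ \Longrightarrow\ z^*\text{ is an NE}\ \Longrightarrow\ z^*\text{ is a QNE}\ \Longleftrightarrow\ z^*\in\mathrm{Sol}.$$ If moreover the objectives are block multiconvex, i.e. $\theta_x(\cdot,y)$ is convex on $\mathcal{X}$ for each fixed $y\in\mathcal{Y}$ and $\theta_y(x,\cdot)$ is convex on $\mathcal{Y}$ for each fixed $x\in\mathcal{X}$, then $$z^*\in\mathrm{Sol}_m\ \Longrightarrow\ z^*\text{ is an MNE}\ \Longleftrightarrow\ z^*\text{ is an NE}\ \Longleftrightarrow\ z^*\text{ is a QNE}\ \Longleftrightarrow\ z^*\in\mathrm{Sol}.$$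
   Context: $\mathrm{Sol}$: the set of $z^*\in\mathcal{Z}$ with $\langle F(z^* ),z-z^*\rangle\ge0$ for all $z\in\mathcal{Z}$. $\mathrm{Sol}_m$ (Minty solutions): the set of $z^*\in\mathcal{Z}$ with $\langle F(z),z-z^*\rangle\ge0$ for all $z\in\mathcal{Z}$. For $(x^*,y^* )\in\mathcal{X}\times\mathcal{Y}$: - NE (Nash equilibrium): $\theta_x(x^*,y^* )\le\theta_x(x,y^* )$ for all $x\in\mathcal{X}$ and $\theta_y(x^*,y^* )\le\theta_y(x^*,y)$ for all $y\in\mathcal{Y}$. - QNE (quasi-Nash equilibrium): $\langle\nabla_x\theta_x(x^*,y^* ),x-x^*\rangle\ge0$ for all $x\in\mathcal{X}$ and $\langle\nabla_y\theta_y(x^*,y^* ),y-y^*\rangle\ge0$ for all $y\in\mathcal{Y}$. - MNE (Minty Nash equilibrium): $\langle\nabla_x\theta_x(x,y^* ),x-x^*\rangle\ge0$ for all $x\in\mathcal{X}$ and $\langle\nabla_y\theta_y(x^*,y),y-y^*\rangle\ge0$ for all $y\in\mathcal{Y}$. Differentiability on $\mathcal{X}$ (resp. $\mathcal{Y}$) is understood on an open set containing it. *)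

theory Defs
  imports "HOL-Analysis.Analysis"
begin

definition gradient :: "('a::euclidean_space \<Rightarrow> real) \<Rightarrow> 'a \<Rightarrow> 'a" where
  "gradient f x = (THE D. GDERIV f x :> D)"

lemma gradient_eqI:
  fixes f :: "'a::euclidean_space \<Rightarrow> real"
  assumes "GDERIV f x :> D"
  shows "gradient f x = D"
  unfolding gradient_def
proof (rule the_equality)
  fix E assume "GDERIV f x :> E"
  then have "(\<lambda>h. h \<bullet> E) = (\<lambda>h. h \<bullet> D)"
    using assms has_derivative_unique unfolding gderiv_def by blast
  then show "E = D"
    by (metis euclidean_eqI inner_commute)
qed (fact assms)

lemma GDERIV_gradient:
  fixes f :: "'a::euclidean_space \<Rightarrow> real"
  assumes "f differentiable (at x)"
  shows "GDERIV f x :> gradient f x"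
proof -
  obtain f' where f': "(f has_derivative f') (at x)"
    using assms unfolding differentiable_def by blast
  then have "f' h = h \<bullet> adjoint f' 1" for h
    using adjoint_works[of f' h 1] by (simp add: has_derivative_linear)
  with f' have "GDERIV f x :> adjoint f' 1"
    unfolding gderiv_def by (metis (no_types, lifting) ext)
  then show ?thesis
    using gradient_eqI by metis
qed

text \<open>Continuous differentiability on a set that need not be open is understood on some open set
  containing it; in particular the gradient is well defined at boundary points.\<close>

definition cont_diff_around :: "'a::euclidean_space set \<Rightarrow> ('a \<Rightarrow> real) \<Rightarrow> bool" where
  "cont_diff_around S f \<longleftrightarrow>
    (\<exists>U. open U \<and> S \<subseteq> U \<and> (\<forall>x\<in>U. f differentiable (at x)) \<and> continuous_on U (gradient f))"

definition game_map ::
  "('a::euclidean_space \<Rightarrow> 'b::euclidean_space \<Rightarrow> real) \<Rightarrow> ('a \<Rightarrow> 'b \<Rightarrow> real) \<Rightarrow> 'a \<times> 'b \<Rightarrow> 'a \<times> 'b" where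
  "game_map \<theta>x \<theta>y = (\<lambda>(x, y). (gradient (\<lambda>u. \<theta>x u y) x, gradient (\<lambda>v. \<theta>y x v) y))"

definition Sol :: "'c::real_inner set \<Rightarrow> ('c \<Rightarrow> 'c) \<Rightarrow> 'c set" where
  "Sol Z F = {zs \<in> Z. \<forall>z\<in>Z. F zs \<bullet> (z - zs) \<ge> 0}"

definition Sol_m :: "'c::real_inner set \<Rightarrow> ('c \<Rightarrow> 'c) \<Rightarrow> 'c set" where
  "Sol_m Z F = {zs \<in> Z. \<forall>z\<in>Z. F z \<bullet> (z - zs) \<ge> 0}"

definition NE ::
  "'a set \<Rightarrow> 'b set \<Rightarrow> ('a::euclidean_space \<Rightarrow> 'b::euclidean_space \<Rightarrow> real) \<Rightarrow> ('a \<Rightarrow> 'b \<Rightarrow> real) \<Rightarrow> 'a \<Rightarrow> 'b \<Rightarrow> bool" where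
  "NE X Y \<theta>x \<theta>y xs ys \<longleftrightarrow> xs \<in> X \<and> ys \<in> Y \<and>
    (\<forall>x\<in>X. \<theta>x xs ys \<le> \<theta>x x ys) \<and>
    (\<forall>y\<in>Y. \<theta>y xs ys \<le> \<theta>y xs y)"

definition QNE ::
  "'a set \<Rightarrow> 'b set \<Rightarrow> ('a::euclidean_space \<Rightarrow> 'b::euclidean_space \<Rightarrow> real) \<Rightarrow> ('a \<Rightarrow> 'b \<Rightarrow> real) \<Rightarrow> 'a \<Rightarrow> 'b \<Rightarrow> bool" where
  "QNE X Y \<theta>x \<theta>y xs ys \<longleftrightarrow> xs \<in> X \<and> ys \<in> Y \<and>
    (\<forall>x\<in>X. gradient (\<lambda>u. \<theta>x u ys) xs \<bullet> (x - xs) \<ge> 0) \<and>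
    (\<forall>y\<in>Y. gradient (\<lambda>v. \<theta>y xs v) ys \<bullet> (y - ys) \<ge> 0)"

definition MNE ::
  "'a set \<Rightarrow> 'b set \<Rightarrow> ('a::euclidean_space \<Rightarrow> 'b::euclidean_space \<Rightarrow> real) \<Rightarrow> ('a \<Rightarrow> 'b \<Rightarrow> real) \<Rightarrow> 'a \<Rightarrow> 'b \<Rightarrow> bool" where
  "MNE X Y \<theta>x \<theta>y xs ys \<longleftrightarrow> xs \<in> X \<and> ys \<in> Y \<and>
    (\<forall>x\<in>X. gradient (\<lambda>u. \<theta>x u ys) x \<bullet> (x - xs) \<ge> 0) \<and>
    (\<forall>y\<in>Y. gradient (\<lambda>v. \<theta>y xs v) y \<bullet> (y - ys) \<ge> 0)"

definition block_multiconvex ::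
  "'a set \<Rightarrow> 'b set \<Rightarrow> ('a::euclidean_space \<Rightarrow> 'b::euclidean_space \<Rightarrow> real) \<Rightarrow> ('a \<Rightarrow> 'b \<Rightarrow> real) \<Rightarrow> bool" where
  "block_multiconvex X Y \<theta>x \<theta>y \<longleftrightarrow>
    (\<forall>y\<in>Y. convex_on X (\<lambda>x. \<theta>x x y)) \<and> (\<forall>x\<in>X. convex_on Y (\<lambda>y. \<theta>y x y))"

end

theory Submission
  imports Defs
begin

text \<open>Every arrow except the two that involve \<open>Sol\<close> and \<open>Sol_m\<close> concerns one player at a time, with the
  opponent's strategy held fixed, so it is a statement about one function \<open>f\<close> on a convex set \<open>S\<close>
  and a point \<open>a\<close> of \<open>S\<close>. All three such statements are obtained by restricting \<open>f\<close> to the segment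
  from \<open>a\<close> to another point \<open>x\<close> of \<open>S\<close>, along which the derivative is the inner product of the
  gradient with \<open>x - a\<close> (\<open>GDERIV_along_line\<close>):

  \<^item> A Minty solution is a minimiser (\<open>minty_imp_minimum\<close>): the Minty inequality at a point of the
    segment says that the derivative of \<open>f\<close> there is nonnegative, so \<open>f\<close> increases from \<open>a\<close> to \<open>x\<close>.
  \<^item> A minimiser is stationary (\<open>minimum_imp_stationary\<close>): the difference quotients at \<open>a\<close> are
    nonnegative.
  \<^item> If \<open>f\<close> is convex, it lies above its tangents (\<open>convex_on_above_tangent\<close>). The tangent at
    \<open>a\<close> turns stationarity of \<open>a\<close> into minimality, and the tangents at the other points, evaluated
    at \<open>a\<close>, turn minimality into the Minty inequality.

  The two remaining arrows pass between variational inequalities on \<open>X \<times> Y\<close> and pairs of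
  variational inequalities. The inner product on \<open>X \<times> Y\<close> is the sum of the inner products of the
  blocks; restricting to points that differ from the candidate in one block isolates the
  inequality of one player, and adding the two inequalities recovers the joint one. For \<open>Sol_m\<close> only
  the first direction is available, because the gradient is evaluated at the test point: in the
  Minty inequalities of the players the opponent stays at equilibrium, while in the joint one both
  blocks move.\<close>

section \<open>Differentiable functions along a segment\<close>

lemma GDERIV_along_line:
  fixes f :: "'a::real_inner \<Rightarrow> real"
  assumes "GDERIV f (a + t *\<^sub>R d) :> g"
  shows "((\<lambda>t. f (a + t *\<^sub>R d)) has_real_derivative g \<bullet> d) (at t)"
proof -
  have "((\<lambda>t. a + t *\<^sub>R d) has_derivative (\<lambda>h. h *\<^sub>R d)) (at t)"
    by (auto intro!: derivative_eq_intros)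
  moreover have "(f has_derivative (\<lambda>h. h \<bullet> g)) (at (a + t *\<^sub>R d))"
    using assms by (simp add: gderiv_def)
  ultimately have "((\<lambda>t. f (a + t *\<^sub>R d)) has_derivative (\<lambda>h. (h *\<^sub>R d) \<bullet> g)) (at t)"
    by (rule has_derivative_compose)
  moreover have "(\<lambda>h. (h *\<^sub>R d) \<bullet> g) = (*) (g \<bullet> d)"
    by (auto simp: inner_commute mult.commute)
  ultimately show ?thesis
    by (simp add: has_field_derivative_def)
qed

lemma segment_point_in_convex:
  assumes "convex S" "a \<in> S" "x \<in> S" "0 \<le> t" "t \<le> 1"
  shows "a + t *\<^sub>R (x - a) \<in> S"
proof -
  have "(1 - t) *\<^sub>R a + t *\<^sub>R x \<in> S"
    using assms by (simp add: convexD_alt)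
  then show ?thesis
    by (simp add: algebra_simps)
qed

text \<open>The hypothesis says that the difference quotients from the right are at least \<open>c\<close>; the
  inequality passes to their limit. Minimality yields it with \<open>c = 0\<close>, and convexity yields it for
  the negated function.\<close>
lemma GDERIV_ge_if_above_ray:
  fixes f :: "'a::real_inner \<Rightarrow> real"
  assumes g: "GDERIV f a :> g"
    and above: "\<And>t. 0 < t \<Longrightarrow> t \<le> 1 \<Longrightarrow> f a + t * c \<le> f (a + t *\<^sub>R d)"
  shows "c \<le> g \<bullet> d"
proof -
  have "((\<lambda>t. f (a + t *\<^sub>R d)) has_real_derivative g \<bullet> d) (at 0)"
    using GDERIV_along_line[of f a 0 d g] g by simp
  then have "((\<lambda>t. (f (a + t *\<^sub>R d) - f a) / t) \<longlongrightarrow> g \<bullet> d) (at 0)"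
    by (simp add: DERIV_def)
  then have lim: "((\<lambda>t. (f (a + t *\<^sub>R d) - f a) / t) \<longlongrightarrow> g \<bullet> d) (at_right 0)"
    by (rule tendsto_mono[OF at_le, rotated]) simp
  have "c \<le> (f (a + t *\<^sub>R d) - f a) / t" if "0 < t" "t < 1" for t
    using above[of t] that by (simp add: field_simps)
  then have "\<forall>\<^sub>F t in at_right 0. c \<le> (f (a + t *\<^sub>R d) - f a) / t"
    by (auto simp: eventually_at_right[of 0 1] intro: exI[of _ 1])
  with lim show ?thesis
    by (rule tendsto_lowerbound) simp
qed

section \<open>The variational inequalities of a single player\<close>

lemma cont_diff_around_GDERIV:
  assumes "cont_diff_around S f" "x \<in> S"
  shows "GDERIV f x :> gradient f x"
  using assms by (auto simp: cont_diff_around_def intro: GDERIV_gradient)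

text \<open>At \<open>w = a + t (x - a)\<close> the Minty inequality controls the inner product of the gradient with
  \<open>w - a = t (x - a)\<close>, so for \<open>t > 0\<close> dividing by \<open>t\<close> gives the sign of the derivative along the
  segment.\<close>
lemma minty_imp_minimum:
  assumes f: "cont_diff_around S f" and S: "convex S" and a: "a \<in> S"
    and minty: "\<forall>x\<in>S. gradient f x \<bullet> (x - a) \<ge> 0"
    and x: "x \<in> S"
  shows "f a \<le> f x"
proof -
  let ?w = "\<lambda>t. a + t *\<^sub>R (x - a)"
  have w: "?w t \<in> S" if "0 \<le> t" "t \<le> 1" for t
    using segment_point_in_convex[OF S a x that] .
  have deriv: "((\<lambda>t. f (?w t)) has_real_derivative gradient f (?w t) \<bullet> (x - a)) (at t)"
    if "0 \<le> t" "t \<le> 1" for t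
    using GDERIV_along_line[OF cont_diff_around_GDERIV[OF f w[OF that]]] .
  have nonneg: "gradient f (?w t) \<bullet> (x - a) \<ge> 0" if "0 < t" "t < 1" for t
  proof -
    have "0 \<le> gradient f (?w t) \<bullet> (?w t - a)"
      using minty w[of t] that by (metis less_imp_le)
    then show ?thesis
      using that by (simp add: zero_le_mult_iff)
  qed
  have "f (?w 0) \<le> f (?w 1)"
  proof (rule DERIV_nonneg_imp_increasing_open[where f = "\<lambda>t. f (?w t)"])
    show "\<exists>y. ((\<lambda>t. f (?w t)) has_real_derivative y) (at t) \<and> 0 \<le> y" if "0 < t" "t < 1" for t
      using deriv[of t] nonneg[OF that] that by auto
    show "continuous_on {0..1} (\<lambda>t. f (?w t))"
      using deriv by (intro DERIV_atLeastAtMost_imp_continuous_on) auto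
  qed simp
  then show ?thesis
    by simp
qed

lemma minimum_imp_stationary:
  assumes f: "cont_diff_around S f" and S: "convex S" and a: "a \<in> S"
    and min: "\<forall>x\<in>S. f a \<le> f x"
    and x: "x \<in> S"
  shows "gradient f a \<bullet> (x - a) \<ge> 0"
proof (rule GDERIV_ge_if_above_ray[OF cont_diff_around_GDERIV[OF f a]])
  show "f a + t * 0 \<le> f (a + t *\<^sub>R (x - a))" if "0 < t" "t \<le> 1" for t
    using min segment_point_in_convex[OF S a x, of t] that by simp
qed

text \<open>On the segment, a convex \<open>f\<close> lies below the chord from \<open>a\<close> to \<open>x\<close>; hence its slope at \<open>a\<close> is
  at most the slope of the chord.\<close>
lemma convex_on_above_tangent:
  assumes f: "cont_diff_around S f" and conv: "convex_on S f" and a: "a \<in> S" and x: "x \<in> S"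
  shows "f a + gradient f a \<bullet> (x - a) \<le> f x"
proof -
  have "- (f x - f a) \<le> (- gradient f a) \<bullet> (x - a)"
  proof (rule GDERIV_ge_if_above_ray)
    show "GDERIV (\<lambda>u. - f u) a :> - gradient f a"
      using cont_diff_around_GDERIV[OF f a] by (rule GDERIV_minus)
    show "- f a + t * (- (f x - f a)) \<le> - f (a + t *\<^sub>R (x - a))" if "0 < t" "t \<le> 1" for t
    proof -
      have "f ((1 - t) *\<^sub>R a + t *\<^sub>R x) \<le> (1 - t) * f a + t * f x"
        using convex_onD[OF conv, of t a x] that a x by simp
      then show ?thesis
        by (simp add: algebra_simps)
    qed
  qed
  then show ?thesis
    by simp
qed

lemma convex_on_stationary_imp_minimum:
  assumes "cont_diff_around S f" "convex_on S f" "a \<in> S" "x \<in> S"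
    and "gradient f a \<bullet> (x - a) \<ge> 0"
  shows "f a \<le> f x"
  using convex_on_above_tangent[OF assms(1-4)] assms(5) by linarith

lemma convex_on_minimum_imp_minty:
  assumes "cont_diff_around S f" "convex_on S f" "a \<in> S" "x \<in> S"
    and "f a \<le> f x"
  shows "gradient f x \<bullet> (x - a) \<ge> 0"
proof -
  have "f x + gradient f x \<bullet> (a - x) \<le> f a"
    using convex_on_above_tangent[OF assms(1,2,4,3)] .
  then show ?thesis
    using assms(5) by (simp add: inner_diff_right)
qed

section \<open>Joint variational inequalities and the game\<close>

text \<open>Testing the joint Minty inequality at \<open>(x, ys)\<close> and at \<open>(xs, y)\<close> kills one of the two blocks.\<close>
lemma Sol_m_imp_MNE:
  assumes "(xs, ys) \<in> Sol_m (X \<times> Y) (game_map \<theta>x \<theta>y)"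
  shows "MNE X Y \<theta>x \<theta>y xs ys"
proof -
  have mem: "xs \<in> X" "ys \<in> Y"
    and minty: "\<And>x y. x \<in> X \<Longrightarrow> y \<in> Y \<Longrightarrow> game_map \<theta>x \<theta>y (x, y) \<bullet> ((x, y) - (xs, ys)) \<ge> 0"
    using assms by (auto simp: Sol_m_def)
  show ?thesis
    unfolding MNE_def
    using mem minty[of _ ys] minty[of xs] by (simp add: game_map_def)
qed

lemma QNE_iff_Sol:
  "QNE X Y \<theta>x \<theta>y xs ys \<longleftrightarrow> (xs, ys) \<in> Sol (X \<times> Y) (game_map \<theta>x \<theta>y)"
proof
  assume "QNE X Y \<theta>x \<theta>y xs ys"
  then show "(xs, ys) \<in> Sol (X \<times> Y) (game_map \<theta>x \<theta>y)"
    by (auto simp: QNE_def Sol_def game_map_def)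
next
  assume "(xs, ys) \<in> Sol (X \<times> Y) (game_map \<theta>x \<theta>y)"
  then have mem: "xs \<in> X" "ys \<in> Y"
    and vi: "\<And>x y. x \<in> X \<Longrightarrow> y \<in> Y \<Longrightarrow> game_map \<theta>x \<theta>y (xs, ys) \<bullet> ((x, y) - (xs, ys)) \<ge> 0"
    by (auto simp: Sol_def)
  show "QNE X Y \<theta>x \<theta>y xs ys"
    unfolding QNE_def
    using mem vi[of _ ys] vi[of xs] by (simp add: game_map_def)
qed

theorem mainTheorem5:
  fixes X :: "(real ^ 'n) set" and Y :: "(real ^ 'm) set"
    and \<theta>x \<theta>y :: "real ^ 'n \<Rightarrow> real ^ 'm \<Rightarrow> real"
    and xs :: "real ^ 'n" and ys :: "real ^ 'm"
  assumes "closed X" "convex X" "closed Y" "convex Y"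
    and "\<And>y. y \<in> Y \<Longrightarrow> cont_diff_around X (\<lambda>x. \<theta>x x y)"
    and "\<And>x. x \<in> X \<Longrightarrow> cont_diff_around Y (\<lambda>y. \<theta>y x y)"
    and "(xs, ys) \<in> X \<times> Y"
  shows "((xs, ys) \<in> Sol_m (X \<times> Y) (game_map \<theta>x \<theta>y) \<longrightarrow> MNE X Y \<theta>x \<theta>y xs ys) \<and>
      (MNE X Y \<theta>x \<theta>y xs ys \<longrightarrow> NE X Y \<theta>x \<theta>y xs ys) \<and>
      (NE X Y \<theta>x \<theta>y xs ys \<longrightarrow> QNE X Y \<theta>x \<theta>y xs ys) \<and>
      (QNE X Y \<theta>x \<theta>y xs ys \<longleftrightarrow> (xs, ys) \<in> Sol (X \<times> Y) (game_map \<theta>x \<theta>y)) \<and>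
      (block_multiconvex X Y \<theta>x \<theta>y \<longrightarrow>
        ((xs, ys) \<in> Sol_m (X \<times> Y) (game_map \<theta>x \<theta>y) \<longrightarrow> MNE X Y \<theta>x \<theta>y xs ys) \<and>
        (MNE X Y \<theta>x \<theta>y xs ys \<longleftrightarrow> NE X Y \<theta>x \<theta>y xs ys) \<and>
        (NE X Y \<theta>x \<theta>y xs ys \<longleftrightarrow> QNE X Y \<theta>x \<theta>y xs ys) \<and>
        (QNE X Y \<theta>x \<theta>y xs ys \<longleftrightarrow> (xs, ys) \<in> Sol (X \<times> Y) (game_map \<theta>x \<theta>y)))"
proof -
  have mem: "xs \<in> X" "ys \<in> Y"
    using assms(7) by auto
  note dx = assms(5)[OF mem(2)] and dy = assms(6)[OF mem(1)]
  have MNE_NE: "MNE X Y \<theta>x \<theta>y xs ys \<longrightarrow> NE X Y \<theta>x \<theta>y xs ys"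
    using minty_imp_minimum[OF dx \<open>convex X\<close> mem(1)] minty_imp_minimum[OF dy \<open>convex Y\<close> mem(2)]
    by (simp add: MNE_def NE_def)
  have NE_QNE: "NE X Y \<theta>x \<theta>y xs ys \<longrightarrow> QNE X Y \<theta>x \<theta>y xs ys"
    using minimum_imp_stationary[OF dx \<open>convex X\<close> mem(1)]
      minimum_imp_stationary[OF dy \<open>convex Y\<close> mem(2)]
    by (simp add: NE_def QNE_def)
  have convex: "(QNE X Y \<theta>x \<theta>y xs ys \<longrightarrow> NE X Y \<theta>x \<theta>y xs ys) \<and>
      (NE X Y \<theta>x \<theta>y xs ys \<longrightarrow> MNE X Y \<theta>x \<theta>y xs ys)"
    if "block_multiconvex X Y \<theta>x \<theta>y"
  proof -
    have cx: "convex_on X (\<lambda>x. \<theta>x x ys)" and cy: "convex_on Y (\<lambda>y. \<theta>y xs y)"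
      using that mem by (auto simp: block_multiconvex_def)
    have "QNE X Y \<theta>x \<theta>y xs ys \<longrightarrow> NE X Y \<theta>x \<theta>y xs ys"
      using convex_on_stationary_imp_minimum[OF dx cx mem(1)]
        convex_on_stationary_imp_minimum[OF dy cy mem(2)]
      by (simp add: QNE_def NE_def)
    moreover have "NE X Y \<theta>x \<theta>y xs ys \<longrightarrow> MNE X Y \<theta>x \<theta>y xs ys"
      using convex_on_minimum_imp_minty[OF dx cx mem(1)]
        convex_on_minimum_imp_minty[OF dy cy mem(2)]
      by (simp add: NE_def MNE_def)
    ultimately show ?thesis ..
  qed
  show ?thesis
    using Sol_m_imp_MNE[of xs ys X Y \<theta>x \<theta>y] QNE_iff_Sol[of X Y \<theta>x \<theta>y xs ys]
      MNE_NE NE_QNE convex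
    by argo
qed

end
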